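(* Let $\varepsilon_1,\varepsilon_2,\varepsilon_3$ be arbitrary nonnegative real numbers, let $\alpha\in\mathbb{R}$, and assume that the function $H:D\to\mathbb{R}$ satisfies the following three conditions. (i) For every $(x,y,z)\in D$ and every rearrangement (permutation) $(x',y',z')$ of the triple $(x,y,z)$, \[ \left|H(x,y,z)-H(x',y',z')\right|\le \varepsilon_1 . \] (ii) For every $(x,y,z)\in D^{\circ}$, \[ \left|H(x,y,z)-H(x+y,0,z)-H(x,y,0)\right|\le \varepsilon_2 . \] (iii) For all $t,x,y\in\mathbb{R}_{++}$, \[ \left|H(tx,ty,0)-t^{\alpha}H(x,y,0)\right|\le \varepsilon_3 . \] Then the following hold. (a) If $\alpha=1$, there exists a function $\varphi:\mathbb{R}_{++}\to\mathbb{R}$ satisfying \[ \varphi(xy)=x\varphi(y)+y\varphi(x)\qquad (x,y\in\mathbb{R}_{++}) \] such that \[ \left|H(x,y,z)-\left[\varphi(x+y+z)-\varphi(x)-\varphi(y)-\varphi(z)\right]\right|\le \varepsilon_1+\varepsilon_2 \] for all $(x,y,z)\in D^{\circ}$. (b) If $\alpha=0$, there exists a constant $a\in\mathbb{R}$ such that \[ \left|H(x,y,z)-a\right|\le 8\varepsilon_3+25\varepsilon_2+49\varepsilon_1 \] for all $(x,y,z)\in D^{\circ}$. (c) If $\alpha\notin\{0,1\}$, there exists a constant $c\in\mathbb{R}$ such that \[ \left|H(x,y,z)-c\left[(x+y+z)^{\alpha}-x^{\alpha}-y^{\alpha}-z^{\alpha}\right]\right|\le \varepsilon_1+\varepsilon_2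 \] for all $(x,y,z)\in D^{\circ}$.
   Context: $\mathbb{R}_{++}$ denotes the set of positive real numbers. $D=\{(x,y,z)\in\mathbb{R}^3 : x\ge 0,\ y\ge 0,\ z\ge 0,\ x+y+z>0\}$, and $D^{\circ}$ denotes the interior of $D$, i.e. $D^{\circ}=\mathbb{R}_{++}^3$. *)

theory Defs
  imports "HOL-Analysis.Analysis" "HOL-Library.Multiset"
begin

definition D :: "(real \<times> real \<times> real) set" where
  "D = {(x, y, z). x \<ge> 0 \<and> y \<ge> 0 \<and> z \<ge> 0 \<and> x + y + z > 0}"

lemma interior_D: "interior D = {(x, y, z). x > 0 \<and> y > 0 \<and> z > 0}"
proof -
  have eq: "{(x, y, z). x > 0 \<and> y > 0 \<and> z > 0} = {0<..} \<times> {0<..} \<times> {(0::real)<..}"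
    by auto
  have "interior D \<subseteq> interior ({0..} \<times> {0..} \<times> {(0::real)..})"
    by (rule interior_mono) (auto simp: D_def)
  then have "interior D \<subseteq> {0<..} \<times> {0<..} \<times> {0<..}"
    by (simp add: interior_Times)
  moreover have "{0<..} \<times> {0<..} \<times> {0<..} \<subseteq> interior D"
    by (rule interior_maximal) (auto simp: D_def intro!: open_Times)
  ultimately show ?thesis
    unfolding eq by blast
qed

text \<open>
  Rearrangement of a triple: equality as multisets, i.e. repeated entries keep their
  multiplicities.
\<close>
definition rearrangement :: "real \<times> real \<times> real \<Rightarrow> real \<times> real \<times> real \<Rightarrow> bool" where
  "rearrangement = (\<lambda>(x, y, z) (x', y', z'). {#x', y', z'#} = {#x, y, z#})"

end

theory Submission
  imports Defs "HOL-Computational_Algebra.Polynomial"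
begin

text \<open>
  Put \<open>F x y = H (x, y, 0)\<close>.  The recursion and symmetry express \<open>H (x, y, z)\<close> up to \<open>\<epsilon>1 + \<epsilon>2\<close> as
  \<open>F (x + y) z + F x y\<close>, so everything is about \<open>F\<close> on pairs of positive reals.  Symmetry makes \<open>F\<close> an
  approximately symmetric 2-cocycle for addition, and the third hypothesis makes it approximately
  homogeneous of degree \<open>\<alpha>\<close>, all up to bounded errors (\<open>entropy_defects\<close>).

  If \<open>\<alpha> \<noteq> 0\<close>, scaling the arguments multiplies the errors by unbounded factors, and so \<open>F\<close> is exactly
  symmetric, homogeneous and a cocycle (\<open>bounded_defects_imp_exact\<close>); it remains to show that it is a
  coboundary of the required shape, and no further error arises.  For \<open>\<alpha> \<noteq> 1\<close> this is a short
  computation (\<open>powr_homogeneous_cocycle\<close>).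

  For \<open>\<alpha> = 1\<close> the idea is to read \<open>F\<close>, after extension to all reals by oddness, as the addition law
  of a commutative ring: pairs of reals with \<open>(x, a) + (y, b) = (x + y, a + b + F x y)\<close> and
  \<open>(x, a) * (y, b) = (x * y, x * b + y * a)\<close>.  It projects onto the reals with a kernel of square zero.
  The required \<open>\<phi>\<close> is exactly a ring section \<open>x \<mapsto> (x, \<phi> x)\<close> of this projection:
  additivity says that \<open>F\<close> is the coboundary of \<open>\<phi>\<close>, and multiplicativity is the Leibniz rule.  A
  section exists because the reals have characteristic zero: by Zorn's lemma there is a maximal
  subring with a section, a transcendental element can be lifted arbitrarily, and an algebraic one
  by a Newton step (\<open>exists_compatible_lift\<close>, \<open>section_on_adjoin\<close>, \<open>exists_ring_section\<close>).

  For \<open>\<alpha> = 0\<close> scaling does not help, but \<open>F x y\<close> depends up to \<open>\<epsilon>3\<close> only on the ratio of its arguments,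
  and comparing two suitable instances of the cocycle equation shows that \<open>F\<close> stays close to \<open>F 1 1\<close>
  (\<open>degree_zero_nearly_constant\<close>); the constant \<open>a\<close> is \<open>2 * F 1 1\<close>.
\<close>

section \<open>Symmetric cocycles\<close>

definition sym_cocycle_on :: "'a::ab_semigroup_add set \<Rightarrow> ('a \<Rightarrow> 'a \<Rightarrow> 'b::ab_group_add) \<Rightarrow> bool" where
  "sym_cocycle_on A F \<longleftrightarrow>
     (\<forall>x\<in>A. \<forall>y\<in>A. x + y \<in> A \<and> F x y = F y x) \<and>
     (\<forall>x\<in>A. \<forall>y\<in>A. \<forall>z\<in>A. F (x + y) z + F x y = F x (y + z) + F y z)"

text \<open>
  Both sides combine the four arguments two by two.  The cocycle equation allows to split off
  \<open>d\<close> last instead, and the remaining combination of \<open>a\<close>, \<open>b\<close>, \<open>c\<close> is symmetric.  In this form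
  the cocycle equation makes the lifted evaluation of polynomials additive (\<open>lift_part_add\<close> below)
  and settles the power case (\<open>powr_homogeneous_cocycle\<close>).
\<close>
lemma sym_cocycle_on_interchange:
  assumes F: "sym_cocycle_on A F" and A: "a \<in> A" "b \<in> A" "c \<in> A" "d \<in> A"
  shows "F a b + F c d + F (a + b) (c + d) = F a c + F b d + F (a + c) (b + d)"
proof -
  have cl: "x + y \<in> A" and sy: "F x y = F y x" if "x \<in> A" "y \<in> A" for x y
    using F that by (auto simp: sym_cocycle_on_def)
  have co: "F (x + y) z + F x y = F x (y + z) + F y z" if "x \<in> A" "y \<in> A" "z \<in> A" for x y z
    using F that by (auto simp: sym_cocycle_on_def)
  have 1: "F (a + b) (c + d) + F c d = F (a + b + c) d + F (a + b) c"
    using co[of "a + b" c d] A cl by simp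
  have 2: "F (a + c) (b + d) + F b d = F (a + c + b) d + F (a + c) b"
    using co[of "a + c" b d] A cl by simp
  have 3: "F (a + b) c + F a b = F (a + c) b + F a c"
    using co[of a b c] co[of a c b] sy[of b c] A by (simp add: add.commute)
  have "F a b + F c d + F (a + b) (c + d) = F a b + (F (a + b + c) d + F (a + b) c)"
    using 1 by (simp add: algebra_simps)
  also have "\<dots> = F (a + c + b) d + (F (a + c) b + F a c)"
    using 3 by (simp add: ac_simps)
  also have "\<dots> = F a c + F b d + F (a + c) (b + d)"
    using 2 by (simp add: ac_simps)
  finally show ?thesis .
qed

definition polys_over :: "'a::comm_ring_1 set \<Rightarrow> 'a poly set" where
  "polys_over K = {p. \<forall>i. coeff p i \<in> K}"

lemma pCons_in_polys_over [simp]: "pCons c p \<in> polys_over K \<longleftrightarrow> c \<in> K \<and> p \<in> polys_over K"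
proof -
  have "(\<forall>i. P i) \<longleftrightarrow> P 0 \<and> (\<forall>i. P (Suc i))" for P
    by (metis not0_implies_Suc)
  from this[of "\<lambda>i. coeff (pCons c p) i \<in> K"] show ?thesis by (simp add: polys_over_def)
qed

section \<open>Homogeneous cocycles over a field of characteristic zero\<close>

text \<open>
  A homogeneous cocycle is the same as a commutative square-zero extension of the field: on pairs,
  the operations \<open>(x, a) + (y, b) = (x + y, a + b + F x y)\<close> and \<open>(x, a) * (y, b) = (x * y, x * b + y * a)\<close>
  form a ring, associativity of addition being the cocycle equation and distributivity being
  homogeneity.  The pairs \<open>(0, a)\<close> form an ideal with square zero.
\<close>
locale homogeneous_cocycle =
  fixes F :: "'a::field_char_0 \<Rightarrow> 'a \<Rightarrow> 'a"
  assumes cocycle: "sym_cocycle_on UNIV F"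
    and homogeneous: "F (t * x) (t * y) = t * F x y"
begin

lemma F_commute: "F x y = F y x"
  using cocycle by (auto simp: sym_cocycle_on_def)

lemma F_cocycle: "F (x + y) z + F x y = F x (y + z) + F y z"
  using cocycle by (auto simp: sym_cocycle_on_def)

lemmas F_interchange = sym_cocycle_on_interchange[OF cocycle UNIV_I UNIV_I UNIV_I UNIV_I]

lemma F_0 [simp]: "F 0 y = 0" "F y 0 = 0"
proof -
  have "F 0 0 = 0" using homogeneous[of 0 0 0] by simp
  then show "F 0 y = 0" using F_cocycle[of 0 0 y] by simp
  then show "F y 0 = 0" by (simp add: F_commute)
qed

lemma F_minus: "F (- x) (- y) = - F x y"
  using homogeneous[of "-1" x y] by simp

lemma F_minus_self [simp]: "F x (- x) = 0"
proof -
  have "F x (- x) = - F x (- x)"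
    using F_minus[of x "- x"] F_commute[of "- x" x] by simp
  then have "2 * F x (- x) = 0" by (metis eq_neg_iff_add_eq_0 mult_2)
  then show ?thesis by simp
qed

lemma F_add_minus: "F (x + y) (- y) = - F x y"
  using F_cocycle[of x y "- y"] by (simp add: eq_neg_iff_add_eq_0)

text \<open>
  This says that \<open>K\<close> is a subring and \<open>x \<mapsto> (x, \<phi> x)\<close> is a ring homomorphism from it into the extension.
\<close>
definition section_on :: "'a set \<Rightarrow> ('a \<Rightarrow> 'a) \<Rightarrow> bool" where
  "section_on K \<phi> \<longleftrightarrow> 1 \<in> K \<and> (\<forall>x\<in>K. - x \<in> K) \<and>
     (\<forall>x\<in>K. \<forall>y\<in>K. x + y \<in> K \<and> x * y \<in> K \<and>
        \<phi> (x + y) = \<phi> x + \<phi> y + F x y \<and> \<phi> (x * y) = x * \<phi> y + y * \<phi> x)"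

lemma section_on_0:
  assumes "section_on K \<phi>"
  shows "0 \<in> K" "\<phi> 0 = 0"
proof -
  have "1 + - 1 \<in> K" using assms unfolding section_on_def by blast
  then show K0: "0 \<in> K" by simp
  then have "\<phi> (0 * 0) = 0 * \<phi> 0 + 0 * \<phi> 0"
    using assms unfolding section_on_def by blast
  then show "\<phi> 0 = 0" by simp
qed

text \<open>
  A homomorphism from the integers is forced by its value at \<open>1\<close>: the first \<open>n\<close> steps of adding
  \<open>(1, 0)\<close> accumulate the values \<open>F i 1\<close>.  It is the starting point for the maximality argument.
\<close>
lemma section_on_Ints: "\<exists>\<phi>. section_on \<int> \<phi>"
proof -
  define c where "c k = (if k \<ge> 0 then \<Sum>i<nat k. F (of_nat i) 1
                          else - (\<Sum>i<nat (- k). F (of_nat i) 1))" for k :: int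
  have step: "c (k + 1) = c k + F (of_int k) 1" for k
  proof (cases "k \<ge> 0")
    case True
    then obtain n where "k = int n" using nonneg_int_cases by blast
    then show ?thesis by (simp add: c_def nat_add_distrib)
  next
    case False
    then obtain n where k: "k = - int (Suc n)" using negD[of k] by auto
    have "F (- (of_nat n + 1)) (- (- 1)) = F (of_nat n) 1"
      using F_add_minus[of "of_nat n" 1] F_minus[of "of_nat n + 1" "- 1"] by simp
    moreover have "nat (- k) = Suc n" "nat (- (k + 1)) = n" using k by auto
    ultimately show ?thesis by (cases n) (auto simp: c_def k algebra_simps)
  qed
  have c0: "c 0 = 0" by (simp add: c_def)
  have c1: "c 1 = 0" using step[of 0] c0 by simp
  have add: "c (k + m) = c k + c m + F (of_int k) (of_int m)" for k m
  proof (induction m rule: int_induct[where k = 0])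
    case base
    show ?case by (simp add: c0)
  next
    case (step1 m)
    have "c (k + (m + 1)) = c k + c m + F (of_int k) (of_int m) + F (of_int k + of_int m) 1"
      using step[of "k + m"] step1 by (simp add: algebra_simps)
    then show ?case
      using step[of m] F_cocycle[of "of_int k" "of_int m" 1] by (simp add: algebra_simps)
  next
    case (step2 m)
    have 1: "c (k + (m - 1)) = c (k + m) - F (of_int k + of_int (m - 1)) 1"
      using step[of "k + (m - 1)"] by simp
    have 2: "c (m - 1) = c m - F (of_int (m - 1)) 1"
      using step[of "m - 1"] by simp
    have 3: "F (of_int k + of_int (m - 1)) 1
        = F (of_int k) (of_int m) + F (of_int (m - 1)) 1 - F (of_int k) (of_int (m - 1))"
      using F_cocycle[of "of_int k" "of_int (m - 1)" 1] by (simp add: eq_diff_eq)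
    show ?case unfolding 1 2 3 step2(2) by simp
  qed
  have mult: "c (k * m) = of_int k * c m + of_int m * c k" for k m
  proof (induction k rule: int_induct[where k = 0])
    case base
    show ?case by (simp add: c0)
  next
    case (step1 k)
    have "c ((k + 1) * m) = c (k * m) + c m + of_int m * F (of_int k) 1"
      using add[of "k * m" m] homogeneous[of "of_int m" "of_int k" 1]
      by (simp add: algebra_simps)
    then show ?case using step[of k] step1 by (simp add: algebra_simps)
  next
    case (step2 k)
    have "c (k * m) = c ((k - 1) * m) + c m + of_int m * F (of_int (k - 1)) 1"
      using add[of "(k - 1) * m" m] homogeneous[of "of_int m" "of_int (k - 1)" 1]
      by (simp add: algebra_simps)
    then show ?case using step[of "k - 1"] step2 by (simp add: algebra_simps)
  qed
  define \<phi> where "\<phi> x = c (the_inv of_int x)" for x :: 'a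
  have [simp]: "\<phi> (of_int k) = c k" for k
    by (simp add: \<phi>_def the_inv_f_f inj_on_def)
  have "\<phi> (x + y) = \<phi> x + \<phi> y + F x y \<and> \<phi> (x * y) = x * \<phi> y + y * \<phi> x"
    if "x \<in> \<int>" "y \<in> \<int>" for x y
  proof -
    from that obtain k m where "x = of_int k" "y = of_int m" by (auto elim!: Ints_cases)
    moreover have "\<phi> (of_int k + of_int m) = c (k + m)" "\<phi> (of_int k * of_int m) = c (k * m)"
      by (metis \<open>\<And>k. \<phi> (of_int k) = c k\<close> of_int_add, metis \<open>\<And>k. \<phi> (of_int k) = c k\<close> of_int_mult)
    ultimately show ?thesis by (simp add: add mult)
  qed
  then have "section_on \<int> \<phi>" by (simp add: section_on_def)
  then show ?thesis by blast
qed

text \<open>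
  The value of a polynomial at the element \<open>(x, a)\<close> of the extension, its coefficients \<open>c\<close> being lifted
  to \<open>(c, \<phi> c)\<close>; the function inside the fold is one Horner step in the operations of the extension.
\<close>
definition eval_lift :: "('a \<Rightarrow> 'a) \<Rightarrow> 'a \<Rightarrow> 'a \<Rightarrow> 'a poly \<Rightarrow> 'a \<times> 'a" where
  "eval_lift \<phi> x a p =
     fold_coeffs (\<lambda>c (u, v). (c + x * u, \<phi> c + x * v + a * u + F c (x * u))) p (0, 0)"

definition lift_part :: "('a \<Rightarrow> 'a) \<Rightarrow> 'a \<Rightarrow> 'a \<Rightarrow> 'a poly \<Rightarrow> 'a" where
  "lift_part \<phi> x a p = snd (eval_lift \<phi> x a p)"

lemma fst_eval_lift: "fst (eval_lift \<phi> x a p) = poly p x"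
proof (induction p)
  case 0
  show ?case by (simp add: eval_lift_def)
next
  case (pCons c p)
  from pCons(1) have "eval_lift \<phi> x a (pCons c p) =
      (\<lambda>(u, v). (c + x * u, \<phi> c + x * v + a * u + F c (x * u))) (eval_lift \<phi> x a p)"
    by (cases "c = 0") (auto simp: eval_lift_def)
  then show ?case using pCons(2) by (simp add: split_beta)
qed

lemma lift_part_0 [simp]: "lift_part \<phi> x a 0 = 0"
  by (simp add: lift_part_def eval_lift_def)

lemma lift_part_pCons:
  assumes "\<phi> 0 = 0"
  shows "lift_part \<phi> x a (pCons c p) =
           \<phi> c + x * lift_part \<phi> x a p + a * poly p x + F c (x * poly p x)"
proof (cases "c = 0 \<and> p = 0")
  case True
  then show ?thesis using assms by simp
next
  case False
  then have "eval_lift \<phi> x a (pCons c p) =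
      (\<lambda>(u, v). (c + x * u, \<phi> c + x * v + a * u + F c (x * u))) (eval_lift \<phi> x a p)"
    by (cases "c = 0") (auto simp: eval_lift_def)
  then show ?thesis by (simp add: lift_part_def split_beta fst_eval_lift)
qed

context
  fixes K :: "'a set" and \<phi> :: "'a \<Rightarrow> 'a"
  assumes sect: "section_on K \<phi>"
begin

lemma K_closed:
  "0 \<in> K" "1 \<in> K" "\<And>x. x \<in> K \<Longrightarrow> - x \<in> K"
  "\<And>x y. x \<in> K \<Longrightarrow> y \<in> K \<Longrightarrow> x + y \<in> K" "\<And>x y. x \<in> K \<Longrightarrow> y \<in> K \<Longrightarrow> x * y \<in> K"
  using sect section_on_0[OF sect] by (auto simp: section_on_def)

lemma \<phi>_0: "\<phi> 0 = 0"
  using section_on_0[OF sect] by simp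

lemma \<phi>_add: "x \<in> K \<Longrightarrow> y \<in> K \<Longrightarrow> \<phi> (x + y) = \<phi> x + \<phi> y + F x y"
  using sect by (auto simp: section_on_def)

lemma \<phi>_mult: "x \<in> K \<Longrightarrow> y \<in> K \<Longrightarrow> \<phi> (x * y) = x * \<phi> y + y * \<phi> x"
  using sect by (auto simp: section_on_def)

lemma of_nat_in_K: "of_nat n \<in> K"
  by (induction n) (auto intro: K_closed)

lemma polys_over_closed:
  shows polys_over_0: "0 \<in> polys_over K"
    and polys_over_uminus: "p \<in> polys_over K \<Longrightarrow> - p \<in> polys_over K"
    and polys_over_add: "p \<in> polys_over K \<Longrightarrow> q \<in> polys_over K \<Longrightarrow> p + q \<in> polys_over K"
    and polys_over_smult: "c \<in> K \<Longrightarrow> p \<in> polys_over K \<Longrightarrow> smult c p \<in> polys_over K"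
    and polys_over_pderiv: "p \<in> polys_over K \<Longrightarrow> pderiv p \<in> polys_over K"
  using of_nat_in_K[of "Suc n" for n]
  by (auto simp: polys_over_def coeff_pderiv simp del: of_nat_Suc intro: K_closed)

lemma polys_over_mult:
  assumes "p \<in> polys_over K" "q \<in> polys_over K"
  shows "p * q \<in> polys_over K"
  using assms by (induction p) (auto intro!: polys_over_closed K_closed)

lemma lift_part_add:
  assumes "p \<in> polys_over K" "q \<in> polys_over K"
  shows "lift_part \<phi> x a (p + q) =
           lift_part \<phi> x a p + lift_part \<phi> x a q + F (poly p x) (poly q x)"
  using assms
proof (induction p q rule: poly_induct2)
  case 0
  show ?case by simp
next
  case (pCons c p d q)
  then have cd: "\<phi> (c + d) = \<phi> c + \<phi> d + F c d" by (simp add: \<phi>_add)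
  have IH: "lift_part \<phi> x a (p + q) =
      lift_part \<phi> x a p + lift_part \<phi> x a q + F (poly p x) (poly q x)"
    using pCons by simp
  show ?case
    using F_interchange[of c d "x * poly p x" "x * poly q x"]
      homogeneous[of x "poly p x" "poly q x"]
    by (simp add: lift_part_pCons \<phi>_0 cd IH algebra_simps)
qed

lemma lift_part_const: "lift_part \<phi> x a [:c:] = \<phi> c"
  by (simp add: lift_part_pCons \<phi>_0)

lemma lift_part_pCons_0: "lift_part \<phi> x a (pCons 0 p) = x * lift_part \<phi> x a p + a * poly p x"
  by (simp add: lift_part_pCons \<phi>_0)

lemma lift_part_smult:
  assumes "c \<in> K" "p \<in> polys_over K"
  shows "lift_part \<phi> x a (smult c p) = c * lift_part \<phi> x a p + poly p x * \<phi> c"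
  using assms(2)
proof (induction p)
  case 0
  show ?case by simp
next
  case (pCons d p)
  then have "\<phi> (c * d) = c * \<phi> d + d * \<phi> c" using assms by (simp add: \<phi>_mult)
  then show ?case
    using pCons homogeneous[of c d "x * poly p x"]
    by (simp add: lift_part_pCons \<phi>_0 algebra_simps)
qed

lemma lift_part_mult:
  assumes "p \<in> polys_over K" "q \<in> polys_over K"
  shows "lift_part \<phi> x a (p * q) = poly p x * lift_part \<phi> x a q + poly q x * lift_part \<phi> x a p"
  using assms(1)
proof (induction p)
  case 0
  show ?case by simp
next
  case (pCons c p)
  then have c: "c \<in> K" and p: "p \<in> polys_over K" by auto
  have "lift_part \<phi> x a (pCons c p * q) = lift_part \<phi> x a (smult c q + pCons 0 (p * q))"
    by simp
  also have "\<dots> = c * lift_part \<phi> x a q + poly q x * \<phi> c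
      + (x * lift_part \<phi> x a (p * q) + a * (poly p x * poly q x))
      + F (c * poly q x) (x * (poly p x * poly q x))"
    using c p assms(2)
    by (subst lift_part_add) (auto simp: lift_part_smult lift_part_pCons_0 polys_over_smult
          polys_over_mult K_closed)
  also have "F (c * poly q x) (x * (poly p x * poly q x)) = poly q x * F c (x * poly p x)"
    using homogeneous[of "poly q x" c "x * poly p x"] by (simp add: mult_ac)
  finally show ?case
    using pCons(2)[OF p] by (simp add: lift_part_pCons \<phi>_0 algebra_simps)
qed

lemma lift_part_shift: "lift_part \<phi> x a p = lift_part \<phi> x 0 p + a * poly (pderiv p) x"
proof (induction p)
  case 0
  show ?case by simp
next
  case (pCons c p)
  then show ?case by (simp add: lift_part_pCons \<phi>_0 pderiv_pCons algebra_simps)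
qed

text \<open>
  This is Newton's method in the extension, where one step is exact because the ideal has square
  zero.  If \<open>x\<close> is algebraic over \<open>K\<close> and \<open>m\<close> is a nonzero polynomial of least degree that vanishes
  at \<open>x\<close>, then \<open>pderiv m\<close> is nonzero (characteristic zero) of smaller degree, so it does not vanish at
  \<open>x\<close>, and by \<open>lift_part_shift\<close> the lift \<open>(x, a)\<close> can be moved to a root of \<open>m\<close>.  Every other polynomial
  that vanishes at \<open>x\<close> then also vanishes at this lift, by pseudo-division by \<open>m\<close>.  For
  transcendental \<open>x\<close> any lift will do.
\<close>
lemma exists_compatible_lift:
  "\<exists>a. \<forall>p\<in>polys_over K. poly p x = 0 \<longrightarrow> lift_part \<phi> x a p = 0"
proof (cases "\<exists>m\<in>polys_over K. m \<noteq> 0 \<and> poly m x = 0")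
  case False
  then have "\<forall>p\<in>polys_over K. poly p x = 0 \<longrightarrow> lift_part \<phi> x a p = 0" for a
    by force
  then show ?thesis by blast
next
  case True
  define R where "R m \<longleftrightarrow> m \<in> polys_over K \<and> m \<noteq> 0 \<and> poly m x = 0" for m
  obtain m where m: "R m" and min: "\<And>p. R p \<Longrightarrow> degree m \<le> degree p"
    using True ex_has_least_nat[of R _ degree] unfolding R_def by metis
  have "degree m \<noteq> 0"
  proof
    assume "degree m = 0"
    then obtain c where "m = [:c:]" by (rule degree_eq_zeroE)
    then show False using m by (simp add: R_def)
  qed
  then have "pderiv m \<noteq> 0" "degree (pderiv m) < degree m"
    by (auto simp: pderiv_eq_0_iff degree_pderiv)
  then have m': "poly (pderiv m) x \<noteq> 0"
    using min[of "pderiv m"] m polys_over_pderiv[of m] by (auto simp: R_def)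
  define a where "a = - lift_part \<phi> x 0 m / poly (pderiv m) x"
  have am: "lift_part \<phi> x a m = 0"
    using m' by (subst lift_part_shift) (simp add: a_def)
  have "lift_part \<phi> x a p = 0" if "p \<in> polys_over K" "poly p x = 0" for p
    using that
  proof (induction "degree p" arbitrary: p rule: less_induct)
    case less
    show ?case
    proof (cases "p = 0")
      case True
      then show ?thesis by simp
    next
      case False
      then have "R p" using less.prems by (simp add: R_def)
      then have deg: "degree m \<le> degree p" by (rule min)
      \<comment> \<open>A step of pseudo-division cancels the leading terms without leaving \<open>K\<close>, which need not
        be a field.\<close>
      define r where "r = monom (lead_coeff p) (degree p - degree m) * m"
      define q where "q = smult (lead_coeff m) p + - r"
      have mK: "m \<in> polys_over K" and mx: "poly m x = 0" and m0: "m \<noteq> 0"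
        using m by (auto simp: R_def)
      have lc: "lead_coeff p \<in> K" "lead_coeff m \<in> K"
        using less.prems mK by (auto simp: polys_over_def)
      have monK: "monom (lead_coeff p) (degree p - degree m) \<in> polys_over K"
        using lc K_closed(1) by (auto simp: polys_over_def)
      then have rK: "r \<in> polys_over K" unfolding r_def by (rule polys_over_mult[OF _ mK])
      have qK: "q \<in> polys_over K"
        unfolding q_def by (intro polys_over_closed lc rK less.prems)
      have r0: "lift_part \<phi> x a r = 0" "poly r x = 0"
        unfolding r_def using am mx by (simp_all add: lift_part_mult[OF monK mK])
      have "lift_part \<phi> x a (- r) = 0"
        using lift_part_add[OF rK polys_over_uminus[OF rK], of x a] r0 by simp
      then have "lift_part \<phi> x a q = lead_coeff m * lift_part \<phi> x a p"
        unfolding q_def using lift_part_add[OF polys_over_smult[OF lc(2) less.prems(1)]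
            polys_over_uminus[OF rK], of x a] r0 less.prems(2)
        by (simp add: lift_part_smult[OF lc(2) less.prems(1)])
      moreover have "lift_part \<phi> x a q = 0"
      proof (cases "q = 0")
        case True
        then show ?thesis by simp
      next
        case False
        have "degree r = degree p"
        proof -
          have "lead_coeff p \<noteq> 0" using \<open>p \<noteq> 0\<close> by simp
          then have "degree (monom (lead_coeff p) (degree p - degree m)) = degree p - degree m"
            and "monom (lead_coeff p) (degree p - degree m) \<noteq> 0"
            by (rule degree_monom_eq, simp add: monom_eq_0_iff)
          then show ?thesis
            using degree_mult_eq[OF _ m0, of "monom (lead_coeff p) (degree p - degree m)"] deg
            unfolding r_def by linarith
        qed
        then have "degree q \<le> degree p"
          unfolding q_def by (intro degree_add_le) auto
        moreover have "coeff q (degree p) = 0"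
        proof -
          have "coeff r (degree p) = lead_coeff r" using \<open>degree r = degree p\<close> by simp
          also have "\<dots> = lead_coeff p * lead_coeff m"
            unfolding r_def by (simp only: lead_coeff_mult lead_coeff_monom)
          finally show ?thesis by (simp add: q_def)
        qed
        ultimately have "degree q < degree p"
          using False by (metis le_neq_implies_less leading_coeff_0_iff)
        moreover have "poly q x = 0" using r0 less.prems by (simp add: q_def)
        ultimately show ?thesis using less.hyps qK by blast
      qed
      ultimately show ?thesis using m0 by simp
    qed
  qed
  then show ?thesis by blast
qed

text \<open>
  The section extends to the values at \<open>x\<close> of the polynomials over \<open>K\<close>, by evaluating at a lift of
  \<open>x\<close>.  The lift from \<open>exists_compatible_lift\<close> makes the result depend on the value alone.
\<close>
lemma section_on_adjoin:
  "\<exists>K' \<phi>'. section_on K' \<phi>' \<and> x \<in> K' \<and> K \<subseteq> K' \<and> (\<forall>y\<in>K. \<phi>' y = \<phi> y)"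
proof -
  obtain a where a: "\<And>p. p \<in> polys_over K \<Longrightarrow> poly p x = 0 \<Longrightarrow> lift_part \<phi> x a p = 0"
    using exists_compatible_lift by metis
  have wd: "lift_part \<phi> x a p = lift_part \<phi> x a q"
    if pq: "p \<in> polys_over K" "q \<in> polys_over K" "poly p x = poly q x" for p q
  proof -
    have q': "- q \<in> polys_over K" by (rule polys_over_uminus[OF pq(2)])
    have "lift_part \<phi> x a (p + - q) = 0"
      using pq by (intro a polys_over_add q') auto
    moreover have "lift_part \<phi> x a (q + - q) = 0" by simp
    ultimately show ?thesis
      using pq lift_part_add[OF pq(1) q', of x a] lift_part_add[OF pq(2) q', of x a]
      by (metis add_right_cancel)
  qed
  define K' where "K' = (\<lambda>p. poly p x) ` polys_over K"
  define \<phi>' where "\<phi>' y = lift_part \<phi> x a (SOME p. p \<in> polys_over K \<and> poly p x = y)" for y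
  have \<phi>': "\<phi>' (poly p x) = lift_part \<phi> x a p" if "p \<in> polys_over K" for p
    unfolding \<phi>'_def
    by (rule someI2[of _ p]) (use that in \<open>auto intro: wd\<close>)
  have "section_on K' \<phi>'"
    unfolding section_on_def
  proof (intro conjI ballI)
    have "poly [:1:] x \<in> K'" unfolding K'_def by (rule imageI) (simp add: polys_over_0 K_closed)
    then show "1 \<in> K'" by simp
  next
    fix y assume "y \<in> K'"
    then obtain p where p: "p \<in> polys_over K" "y = poly p x" by (auto simp: K'_def)
    then have "poly (- p) x \<in> K'" unfolding K'_def by (intro imageI polys_over_uminus)
    then show "- y \<in> K'" using p by simp
  next
    fix y z assume "y \<in> K'" "z \<in> K'"
    then obtain p q where p: "p \<in> polys_over K" "y = poly p x"
      and q: "q \<in> polys_over K" "z = poly q x" by (auto simp: K'_def)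
    have pq: "p + q \<in> polys_over K" "p * q \<in> polys_over K"
      using p q by (auto intro: polys_over_add polys_over_mult)
    show "y + z \<in> K'" "y * z \<in> K'"
      using imageI[OF pq(1), of "\<lambda>p. poly p x"] imageI[OF pq(2), of "\<lambda>p. poly p x"] p q
      by (auto simp: K'_def)
    show "\<phi>' (y + z) = \<phi>' y + \<phi>' z + F y z"
      using \<phi>'[OF pq(1)] p q by (simp add: \<phi>' lift_part_add)
    show "\<phi>' (y * z) = y * \<phi>' z + z * \<phi>' y"
      using \<phi>'[OF pq(2)] p q by (simp add: \<phi>' lift_part_mult)
  qed
  moreover have "x \<in> K'"
    using imageI[of "[:0, 1:]" "polys_over K" "\<lambda>p. poly p x"]
    by (simp add: K'_def polys_over_0 K_closed)
  moreover have "y \<in> K' \<and> \<phi>' y = \<phi> y" if "y \<in> K" for y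
  proof -
    have "[:y:] \<in> polys_over K" using that by (simp add: polys_over_0)
    from imageI[OF this, of "\<lambda>p. poly p x"] \<phi>'[OF this] show ?thesis
      by (simp add: K'_def lift_part_const)
  qed
  ultimately show ?thesis by blast
qed

end

text \<open>
  Sections are ordered by extension; in terms of graphs this is set inclusion, to which Zorn's
  lemma applies.
\<close>
definition section_graphs :: "('a \<times> 'a) set set" where
  "section_graphs = {S. \<exists>K \<phi>. section_on K \<phi> \<and> S = (\<lambda>x. (x, \<phi> x)) ` K}"

lemma Union_chain_section_graphs:
  assumes "C \<noteq> {}" and chain: "subset.chain section_graphs C"
  shows "\<Union>C \<in> section_graphs"
proof -
  have sub: "C \<subseteq> section_graphs"
    and lin: "\<And>S T. S \<in> C \<Longrightarrow> T \<in> C \<Longrightarrow> S \<subseteq> T \<or> T \<subseteq> S"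
    using chain by (auto simp: subset_chain_def)
  have common: "\<exists>K \<psi>. section_on K \<psi> \<and> x \<in> K \<and> y \<in> K \<and> a = \<psi> x \<and> b = \<psi> y \<and>
      (\<lambda>x. (x, \<psi> x)) ` K \<subseteq> \<Union>C"
    if "(x, a) \<in> \<Union>C" "(y, b) \<in> \<Union>C" for x y a b
  proof -
    from that obtain S T where "S \<in> C" "(x, a) \<in> S" "T \<in> C" "(y, b) \<in> T" by auto
    then obtain U where U: "U \<in> C" "(x, a) \<in> U" "(y, b) \<in> U" using lin by blast
    then obtain K \<psi> where K: "section_on K \<psi>" "U = (\<lambda>x. (x, \<psi> x)) ` K"
      using sub by (auto simp: section_graphs_def)
    have "U \<subseteq> \<Union>C" using U(1) by (rule Union_upper)
    moreover have "x \<in> K" "y \<in> K" "a = \<psi> x" "b = \<psi> y" using U(2,3) K(2) by auto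
    ultimately show ?thesis using K by (intro exI[of _ K] exI[of _ \<psi>]) simp
  qed
  define \<phi> where "\<phi> x = (SOME a. (x, a) \<in> \<Union>C)" for x
  have \<phi>: "\<phi> x = a" if "(x, a) \<in> \<Union>C" for x a
    unfolding \<phi>_def using that
    by (rule someI2) (use common that in blast)
  have graph: "\<Union>C = (\<lambda>x. (x, \<phi> x)) ` Domain (\<Union>C)"
  proof (rule set_eqI)
    fix z :: "'a \<times> 'a"
    show "z \<in> \<Union>C \<longleftrightarrow> z \<in> (\<lambda>x. (x, \<phi> x)) ` Domain (\<Union>C)"
    proof
      assume z: "z \<in> \<Union>C"
      obtain x a where xa: "z = (x, a)" by (cases z)
      then have in_C: "(x, a) \<in> \<Union>C" using z by simp
      show "z \<in> (\<lambda>x. (x, \<phi> x)) ` Domain (\<Union>C)"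
        unfolding xa
      proof (rule image_eqI)
        show "(x, a) = (x, \<phi> x)" using \<phi>[OF in_C] by simp
        show "x \<in> Domain (\<Union>C)" using in_C by (rule DomainI)
      qed
    next
      assume "z \<in> (\<lambda>x. (x, \<phi> x)) ` Domain (\<Union>C)"
      then obtain x where x: "x \<in> Domain (\<Union>C)" "z = (x, \<phi> x)" by (rule imageE)
      from x(1) obtain b where b: "(x, b) \<in> \<Union>C" by (rule DomainE)
      then show "z \<in> \<Union>C" unfolding x(2) \<phi>[OF b] .
    qed
  qed
  have "section_on (Domain (\<Union>C)) \<phi>"
    unfolding section_on_def
  proof (intro conjI ballI)
    obtain S where "S \<in> C" using assms(1) by blast
    then obtain K \<psi> where "section_on K \<psi>" "S = (\<lambda>x. (x, \<psi> x)) ` K"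
      using sub by (auto simp: section_graphs_def)
    then have "(1, \<psi> 1) \<in> S" by (auto simp: section_on_def)
    with \<open>S \<in> C\<close> have "(1, \<psi> 1) \<in> \<Union>C" by (rule UnionI)
    then show "1 \<in> Domain (\<Union>C)" by (rule DomainI)
  next
    fix x assume "x \<in> Domain (\<Union>C)"
    then obtain a where "(x, a) \<in> \<Union>C" by blast
    from common[OF this this] obtain K \<psi> where "section_on K \<psi>" "x \<in> K"
      and sub: "(\<lambda>x. (x, \<psi> x)) ` K \<subseteq> \<Union>C" by auto
    then have "- x \<in> K" by (simp add: section_on_def)
    then have "(- x, \<psi> (- x)) \<in> \<Union>C" by (rule subsetD[OF sub imageI])
    then show "- x \<in> Domain (\<Union>C)" by (rule DomainI)
  next
    fix x y assume "x \<in> Domain (\<Union>C)" "y \<in> Domain (\<Union>C)"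
    then obtain a b where ab: "(x, a) \<in> \<Union>C" "(y, b) \<in> \<Union>C" by blast
    obtain K \<psi> where K: "section_on K \<psi>" "x \<in> K" "y \<in> K"
      and sub: "(\<lambda>x. (x, \<psi> x)) ` K \<subseteq> \<Union>C"
      using common[OF ab] by auto
    have in_C: "(z, \<psi> z) \<in> \<Union>C" if "z \<in> K" for z
      using that by (rule subsetD[OF sub imageI])
    have xy: "x + y \<in> K" "x * y \<in> K" using K by (auto simp: section_on_def)
    show "x + y \<in> Domain (\<Union>C)" "x * y \<in> Domain (\<Union>C)"
      using in_C[OF xy(1)] in_C[OF xy(2)] by (simp_all only: DomainI)
    have eq: "\<phi> z = \<psi> z" if "z \<in> K" for z using \<phi>[OF in_C[OF that]] .
    show "\<phi> (x + y) = \<phi> x + \<phi> y + F x y" "\<phi> (x * y) = x * \<phi> y + y * \<phi> x"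
      using K xy by (auto simp: eq section_on_def)
  qed
  then show ?thesis using graph unfolding section_graphs_def by blast
qed

text \<open>
  The field is formally smooth over the integers, so its square-zero extension splits: a maximal
  partial section must be total because any missing element could be adjoined.
\<close>
lemma exists_ring_section:
  "\<exists>\<phi>. \<forall>x y. \<phi> (x + y) = \<phi> x + \<phi> y + F x y \<and> \<phi> (x * y) = x * \<phi> y + y * \<phi> x"
proof -
  have "section_graphs \<noteq> {}" using section_on_Ints unfolding section_graphs_def by blast
  from subset_Zorn_nonempty[OF this Union_chain_section_graphs]
  obtain M where M: "M \<in> section_graphs" and max: "\<And>S. S \<in> section_graphs \<Longrightarrow> M \<subseteq> S \<Longrightarrow> S = M"
    by metis
  obtain K \<phi> where K: "section_on K \<phi>" and MK: "M = (\<lambda>x. (x, \<phi> x)) ` K"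
    using M by (auto simp: section_graphs_def)
  have "x \<in> K" for x
  proof -
    obtain K' \<phi>' where K': "section_on K' \<phi>'" "x \<in> K'" "K \<subseteq> K'" "\<forall>y\<in>K. \<phi>' y = \<phi> y"
      using section_on_adjoin[OF K, of x] by auto
    have "(\<lambda>y. (y, \<phi>' y)) ` K' = M"
      using K' by (intro max) (auto simp: section_graphs_def MK)
    with K'(2) show "x \<in> K" by (auto simp: MK)
  qed
  with K show ?thesis unfolding section_on_def by blast
qed

end

section \<open>Cocycles on the positive reals\<close>

text \<open>
  If \<open>F x y = f (x + y) - f x - f y\<close>, then this is the same expression for the odd extension of \<open>f\<close>.
  The six sign patterns reflect the symmetry of that expression: on triples with \<open>x + y + z = 0\<close> it is
  a symmetric and odd function, so that it is known once it is known on the two entries of equal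
  sign.
\<close>
definition odd_extension :: "(real \<Rightarrow> real \<Rightarrow> real) \<Rightarrow> real \<Rightarrow> real \<Rightarrow> real" where
  "odd_extension F x y =
     (if x = 0 \<or> y = 0 \<or> x + y = 0 then 0
      else if x > 0 \<and> y > 0 then F x y
      else if x < 0 \<and> y < 0 then - F (- x) (- y)
      else if x > 0 then (if x + y > 0 then - F (x + y) (- y) else F x (- (x + y)))
      else (if x + y > 0 then - F (x + y) (- x) else F y (- (x + y))))"

text \<open>
  The cocycle equation involves four reals \<open>x\<close>, \<open>y\<close>, \<open>z\<close>, \<open>- (x + y + z)\<close> with sum zero.  For each
  pattern of signs, writing all arguments of the extension as sums of positive numbers turns the
  equation into the equation for \<open>F\<close>.  The number of patterns is kept small by oddness, which allows
  to assume that at most one of \<open>x\<close>, \<open>y\<close>, \<open>z\<close> is negative, and by reversing the order of \<open>x\<close>, \<open>y\<close>, \<open>z\<close>.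
\<close>
lemma homogeneous_cocycle_odd_extension:
  assumes F: "sym_cocycle_on {0<..} F"
    and homog: "\<And>t x y. t > 0 \<Longrightarrow> x > 0 \<Longrightarrow> y > 0 \<Longrightarrow> F (t * x) (t * y) = t * F x y"
  shows "homogeneous_cocycle (odd_extension F)"
proof -
  let ?G = "odd_extension F"
  have sy: "F x y = F y x" if "x > 0" "y > 0" for x y
    using F that by (auto simp: sym_cocycle_on_def)
  have co: "F (x + y) z + F x y = F x (y + z) + F y z" if "x > 0" "y > 0" "z > 0" for x y z
    using F that by (auto simp: sym_cocycle_on_def)
  have G_sym: "?G x y = ?G y x" for x y
    by (auto simp: odd_extension_def add.commute sy)
  have G_neg: "?G (- x) (- y) = - ?G x y" for x y
    by (auto simp: odd_extension_def add.commute sy)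
  have G_pos: "?G (t * x) (t * y) = t * ?G x y" if "t > 0" for t x y
  proof -
    have "t * x + t * y = t * (x + y)" by (simp add: algebra_simps)
    then show ?thesis
      using that homog[of t x y] homog[of t "- x" "- y"] homog[of t "x + y" "- y"]
        homog[of t x "- (x + y)", unfolded mult_minus_right] homog[of t "x + y" "- x"]
        homog[of t y "- (x + y)", unfolded mult_minus_right]
      by (auto simp: odd_extension_def zero_less_mult_iff mult_less_0_iff)
  qed
  have G_homog: "?G (t * x) (t * y) = t * ?G x y" for t x y
  proof -
    consider "t > 0" | "t = 0" | "t < 0" by linarith
    then show ?thesis
    proof cases
      case 1
      then show ?thesis by (rule G_pos)
    next
      case 2
      then show ?thesis by (simp add: odd_extension_def)
    next
      case 3
      then show ?thesis using G_neg[of "t * x" "t * y"] G_pos[of "- t" x y] by simp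
    qed
  qed
  have G_turn: "?G x y = ?G x (- (x + y))" for x y
    by (auto simp: odd_extension_def add.commute sy)
  have G_co: "?G (x + y) z + ?G x y = ?G x (y + z) + ?G y z" for x y z
  proof -
    \<comment> \<open>Writing the arguments as sums of positive numbers fixes the sign of their sum.\<close>
    have below: "?G (- a) (a + d) = - F d a" and above: "?G (- (b + d)) b = F b d"
      and both: "?G a b = F a b" if "a > 0" "b > 0" "d > 0" for a b d
      using that by (auto simp: odd_extension_def sy)
    \<comment> \<open>If a partial sum vanishes, the equation reduces to oddness and to the invariance \<open>G_turn\<close>.\<close>
    have degenerate: "?G (x + y) z + ?G x y = ?G x (y + z) + ?G y z"
      if h: "x = 0 \<or> y = 0 \<or> z = 0 \<or> x + y = 0 \<or> y + z = 0 \<or> x + y + z = 0" for x y z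
    proof -
      have zero: "?G 0 u = 0" "?G u 0 = 0" "?G u (- u) = 0" "?G (- u) u = 0" for u
        by (auto simp: odd_extension_def)
      have opp: "?G u (v - u) + ?G (- u) v = 0" for u v
        using G_neg[of u "- v"] G_turn[of u "- v"] by simp
      consider "x = 0" | "y = 0" | "z = 0" | "y = - x" | "z = - y" | "z = - (x + y)"
        using h by force
      then show ?thesis
      proof cases
        case 4
        then show ?thesis using opp[of x z] by (simp add: zero)
      next
        case 5
        then show ?thesis
          using opp[of y "x + y"] G_sym[of "x + y" "- y"] G_sym[of x y] by (simp add: zero)
      next
        case 6
        have "?G (x + y) z = 0" unfolding 6 by (rule zero)
        moreover have "y + z = - x" using 6 by simp
        then have "?G x (y + z) = 0" by (simp only: zero)
        moreover have "?G y z = ?G x y"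
          unfolding 6 using G_turn[of y x] G_sym[of x y] by (simp only: add.commute)
        ultimately show ?thesis by simp
      qed (simp_all add: zero)
    qed
    have first: "?G (x + y) z + ?G x y = ?G x (y + z) + ?G y z"
      if h: "x < 0" "y > 0" "z > 0" for x y z
    proof -
      consider "x + y = 0 \<or> x + y + z = 0" | "x + y > 0" | "x + y < 0" "x + y + z > 0"
        | "x + y + z < 0" by linarith
      then show ?thesis
      proof cases
        case 1
        then show ?thesis by (intro degenerate) auto
      next
        case 2
        define a d where "a = - x" and "d = x + y"
        have v: "x = - a" "y = a + d" "a > 0" "d > 0" using h 2 by (auto simp: a_def d_def)
        show ?thesis
          using co[of a d z] below[of a 1 d] below[of a 1 "d + z"] both[of d z 1]
            both[of "a + d" z 1] sy v h by (simp add: add.assoc)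
      next
        case 3
        define d e where "d = - x - y" and "e = x + y + z"
        have v: "x = - (y + d)" "z = d + e" "d > 0" "e > 0" using 3 by (auto simp: d_def e_def)
        have "?G (- d) (d + e) + ?G (- (y + d)) y = ?G (- (y + d)) ((y + d) + e) + ?G y (d + e)"
          using co[of y d e] below[of d 1 e] above[of 1 y d] below[of "y + d" 1 e]
            both[of y "d + e" 1] sy[of d e] sy[of e "y + d"] v h by simp
        then show ?thesis using v by (simp add: add.assoc)
      next
        case 4
        define d where "d = - x - y - z"
        have v: "x = - (y + z + d)" "d > 0" using 4 by (auto simp: d_def)
        have "?G (- (z + d)) z + ?G (- (y + (z + d))) y = ?G (- ((y + z) + d)) (y + z) + ?G y z"
          using co[of y z d] above[of 1 z d] above[of 1 y "z + d"] above[of 1 "y + z" d]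
            both[of y z 1] v h by simp
        moreover have "x + y = - (z + d)" using v by simp
        ultimately show ?thesis using v by (simp add: add.assoc)
      qed
    qed
    have middle: "?G (x + y) z + ?G x y = ?G x (y + z) + ?G y z"
      if h: "y < 0" "x > 0" "z > 0" "x \<le> z" for x y z
    proof -
      consider "x + y = 0 \<or> y + z = 0 \<or> x + y + z = 0" | "x + y > 0"
        | "x + y < 0" "y + z > 0" | "y + z < 0" "x + y + z > 0" | "x + y + z < 0"
        using h by linarith
      then show ?thesis
      proof cases
        case 1
        then show ?thesis by (intro degenerate) auto
      next
        case 2
        define b d e where "b = - y" and "d = x + y" and "e = y + z"
        have v: "y = - b" "x = b + d" "z = b + e" "b > 0" "d > 0" "e > 0"
          using h 2 by (auto simp: b_def d_def e_def)
        have "?G d (b + e) + ?G (b + d) (- b) = ?G (b + d) e + ?G (- b) (b + e)"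
          using co[of d b e] both[of d "b + e" 1] below[of b 1 d] both[of "b + d" e 1]
            below[of b 1 e] G_sym[of "b + d" "- b"] sy[of b e] v by (simp add: add.commute)
        then show ?thesis using v by simp
      next
        case 3
        define d e where "d = - y - x" and "e = y + z"
        have v: "y = - (x + d)" "z = x + d + e" "d > 0" "e > 0"
          using 3 by (auto simp: d_def e_def)
        have "?G (- d) (d + (x + e)) + ?G (- (x + d)) x = ?G x e + ?G (- (x + d)) ((x + d) + e)"
          using co[of x e d] co[of e x d] both[of x e 1] below[of d 1 "x + e"] above[of 1 x d]
            below[of "x + d" 1 e] sy[of x e] v h by (simp add: add.commute)
        moreover have "x + y = - d" "z = d + (x + e)" "y + z = e" using v by auto
        ultimately show ?thesis using v G_sym[of x y] by (simp add: ac_simps)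
      next
        case 4
        define d e f where "d = - y - x" and "e = - y - z" and "f = x + y + z"
        have v: "y = - (e + f + d)" "x = e + f" "z = d + f" "d > 0" "e > 0" "f > 0"
          using 4 h by (auto simp: d_def e_def f_def)
        have "?G (- d) (d + f) + ?G (- ((e + f) + d)) (e + f)
            = ?G (- e) (e + f) + ?G (- ((d + f) + e)) (d + f)"
          using co[of e f d] below[of d 1 f] below[of e 1 f] above[of 1 "e + f" d]
            above[of 1 "d + f" e] sy[of e f] sy[of d f] sy[of e "f + d"] v
          by (simp add: add.commute)
        moreover have "x + y = - d" "y + z = - e" "y = - ((d + f) + e)" using v by auto
        ultimately show ?thesis using v G_sym[of x y] G_sym[of x "y + z"] by (simp add: ac_simps)
      next
        case 5
        define d where "d = - x - y - z"
        have v: "y = - (x + (z + d))" "y = - (z + (x + d))" "x + y = - (z + d)" "y + z = - (x + d)"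
          "d > 0" using 5 by (auto simp: d_def)
        have "?G (- (z + d)) z + ?G (- (x + (z + d))) x = ?G (- (x + d)) x + ?G (- (z + (x + d))) z"
          using co[of x z d] co[of z x d] above[of 1 z d] above[of 1 x "z + d"] above[of 1 x d]
            above[of 1 z "x + d"] sy[of x z] v h by (simp add: add.commute)
        then show ?thesis using v G_sym[of x y] G_sym[of x "y + z"] by metis
      qed
    qed
    have one: "?G (x + y) z + ?G x y = ?G x (y + z) + ?G y z"
      if h: "x > 0 \<and> y > 0 \<or> x > 0 \<and> z > 0 \<or> y > 0 \<and> z > 0" for x y z
    proof -
      consider "x = 0 \<or> y = 0 \<or> z = 0" | "x > 0" "y > 0" "z > 0" | "x < 0" "y > 0" "z > 0"
        | "z < 0" "x > 0" "y > 0" | "y < 0" "x > 0" "z > 0" "x \<le> z"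
        | "y < 0" "x > 0" "z > 0" "z \<le> x"
        using h by linarith
      then show ?thesis
      proof cases
        case 1
        then show ?thesis by (intro degenerate) auto
      next
        case 2
        then show ?thesis
          using co[of x y z] by (simp add: odd_extension_def)
      next
        case 3
        then show ?thesis by (rule first)
      next
        case 4
        then show ?thesis using first[of z y x] G_sym by (metis add.commute)
      next
        case 5
        then show ?thesis by (rule middle)
      next
        case 6
        then show ?thesis using middle[of y z x] G_sym by (metis add.commute)
      qed
    qed
    consider "x = 0 \<or> y = 0 \<or> z = 0" | "x > 0 \<and> y > 0 \<or> x > 0 \<and> z > 0 \<or> y > 0 \<and> z > 0"
      | "- x > 0 \<and> - y > 0 \<or> - x > 0 \<and> - z > 0 \<or> - y > 0 \<and> - z > 0" by linarith
    then show ?thesis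
    proof cases
      case 1
      then show ?thesis by (intro degenerate) auto
    next
      case 2
      then show ?thesis by (rule one)
    next
      case 3
      have "?G (- (x + y)) (- z) + ?G (- x) (- y) = ?G (- x) (- (y + z)) + ?G (- y) (- z)"
        using one[OF 3] by simp
      then show ?thesis unfolding G_neg by simp
    qed
  qed
  show ?thesis
  proof
    show "sym_cocycle_on UNIV ?G"
      unfolding sym_cocycle_on_def using G_sym G_co by blast
    show "?G (t * x) (t * y) = t * ?G x y" for t x y
      by (rule G_homog)
  qed
qed

text \<open>
  In the interchange identity for \<open>x, x, y, y\<close>, homogeneity turns every term into a multiple of
  \<open>F x y\<close> or of \<open>F 1 1\<close>, and the coefficient \<open>2 powr \<alpha> - 2\<close> of \<open>F x y\<close> vanishes only for \<open>\<alpha> = 1\<close>.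
\<close>
lemma powr_homogeneous_cocycle:
  fixes F :: "real \<Rightarrow> real \<Rightarrow> real"
  assumes F: "sym_cocycle_on {0<..} F"
    and homog: "\<And>t x y. t > 0 \<Longrightarrow> x > 0 \<Longrightarrow> y > 0 \<Longrightarrow> F (t * x) (t * y) = t powr \<alpha> * F x y"
    and "\<alpha> \<noteq> 1" "x > 0" "y > 0"
  shows "F x y = F 1 1 / (2 powr \<alpha> - 2) * ((x + y) powr \<alpha> - x powr \<alpha> - y powr \<alpha>)"
proof -
  have "2 powr \<alpha> \<noteq> (2 powr 1 :: real)" using \<open>\<alpha> \<noteq> 1\<close> by (subst powr_inj) auto
  then have ne: "2 powr \<alpha> - 2 \<noteq> (0::real)" by simp
  have "F x x + F y y + F (x + x) (y + y) = F x y + F x y + F (x + y) (x + y)"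
    using sym_cocycle_on_interchange[OF F, of x x y y] assms by simp
  moreover have "F x x = x powr \<alpha> * F 1 1" "F y y = y powr \<alpha> * F 1 1"
    "F (x + y) (x + y) = (x + y) powr \<alpha> * F 1 1"
    using homog[of x 1 1] homog[of y 1 1] homog[of "x + y" 1 1] assms by simp_all
  moreover have "F (x + x) (y + y) = 2 powr \<alpha> * F x y"
    using homog[of 2 x y] \<open>x > 0\<close> \<open>y > 0\<close> unfolding mult_2 by simp
  ultimately have "(2 powr \<alpha> - 2) * F x y = F 1 1 * ((x + y) powr \<alpha> - x powr \<alpha> - y powr \<alpha>)"
    by (simp add: algebra_simps)
  then have "F x y = F 1 1 * ((x + y) powr \<alpha> - x powr \<alpha> - y powr \<alpha>) / (2 powr \<alpha> - 2)"
    by (simp only: nonzero_eq_divide_eq[OF ne] mult.commute[of "F x y"])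
  then show ?thesis by simp
qed

section \<open>Approximate cocycles\<close>

lemma homogeneous_bounded_imp_zero:
  fixes c :: real
  assumes "\<alpha> \<noteq> 0" and bound: "\<And>t. t > 0 \<Longrightarrow> \<bar>t powr \<alpha> * c\<bar> \<le> B"
  shows "c = 0"
proof (rule ccontr)
  assume "c \<noteq> 0"
  define s where "s = (\<bar>B\<bar> + 1) / \<bar>c\<bar>"
  have "s > 0" using \<open>c \<noteq> 0\<close> by (simp add: s_def)
  then have "(s powr (1 / \<alpha>)) powr \<alpha> = s" using assms by (simp add: powr_powr)
  then have "\<bar>s * c\<bar> \<le> B" using bound[of "s powr (1 / \<alpha>)"] \<open>s > 0\<close> by simp
  moreover have "\<bar>s * c\<bar> = \<bar>B\<bar> + 1" using \<open>c \<noteq> 0\<close> by (simp add: s_def abs_mult)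
  ultimately show False by linarith
qed

text \<open>
  For degree zero the arguments of \<open>F\<close> matter only through their ratio.  For \<open>x > y\<close>, the triples
  \<open>(x, y, z)\<close> and \<open>(1, 1, w)\<close> in the proof are chosen such that \<open>x + y : z = 2 : w\<close>, and such that the
  two terms \<open>F x (y + z)\<close> and \<open>F y z\<close> on the right of the first cocycle equation have the ratios of
  \<open>F 1 w\<close> and \<open>F 1 (1 + w)\<close> on the right of the second one, in exchanged order.  Comparing the two
  equations leaves \<open>F x y\<close> against \<open>F 1 1\<close>.
\<close>
lemma degree_zero_nearly_constant:
  fixes F :: "real \<Rightarrow> real \<Rightarrow> real"
  assumes sy: "\<And>x y. x > 0 \<Longrightarrow> y > 0 \<Longrightarrow> \<bar>F x y - F y x\<bar> \<le> \<epsilon>"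
    and co: "\<And>x y z. x > 0 \<Longrightarrow> y > 0 \<Longrightarrow> z > 0 \<Longrightarrow>
      \<bar>F (x + y) z + F x y - F x (y + z) - F y z\<bar> \<le> \<eta>"
    and homog: "\<And>t x y. t > 0 \<Longrightarrow> x > 0 \<Longrightarrow> y > 0 \<Longrightarrow> \<bar>F (t * x) (t * y) - F x y\<bar> \<le> \<delta>"
    and xy: "x > 0" "y > 0"
  shows "\<bar>F x y - F 1 1\<bar> \<le> 2 * \<eta> + 3 * \<delta> + \<epsilon>"
proof -
  have scaled: "\<bar>F a b - F u v\<bar> \<le> \<delta>" if "a * v = b * u" "a > 0" "b > 0" "u > 0" "v > 0" for a b u v
  proof -
    have "a = a / u * u" "b = a / u * v" using that by (simp_all add: field_simps)
    then show ?thesis using homog[of "a / u" u v] that by simp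
  qed
  have gt: "\<bar>F x y - F 1 1\<bar> \<le> 2 * \<eta> + 3 * \<delta>" if "x > y" "y > 0" for x y
  proof -
    define d where "d = x - y"
    define z where "z = y * (x + y) / d"
    define w where "w = 2 * y / d"
    have x: "x = y + d" and d: "d > 0" using that by (auto simp: d_def)
    have pos: "x > 0" "z > 0" "w > 0" "y > 0"
      using that d by (auto simp: z_def w_def)
    have e: "(x + y) * w = z * (1 + 1)" "x * w = (y + z) * 1" "y * (1 + w) = z * 1"
      using d by (simp_all add: z_def w_def x field_simps)
    have "\<bar>F (x + y) z - F (1 + 1) w\<bar> \<le> \<delta>" using scaled[OF e(1)] pos by simp
    moreover have "\<bar>F x (y + z) - F 1 w\<bar> \<le> \<delta>" using scaled[OF e(2)] pos by simp
    moreover have "\<bar>F y z - F 1 (1 + w)\<bar> \<le> \<delta>" using scaled[OF e(3)] pos by simp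
    ultimately show ?thesis
      using co[of x y z] co[of 1 1 w] pos by linarith
  qed
  have "0 \<le> \<delta>" "0 \<le> \<eta>" "0 \<le> \<epsilon>" using homog[of 1 1 1] co[of 1 1 1] sy[of 1 1] by auto
  consider "x > y" | "x < y" | "x = y" by linarith
  then show ?thesis
  proof cases
    case 1
    then show ?thesis using gt xy \<open>0 \<le> \<epsilon>\<close> by force
  next
    case 2
    then show ?thesis using gt[where x = y and y = x] sy[of x y] xy by linarith
  next
    case 3
    then show ?thesis using homog[of x 1 1] xy \<open>0 \<le> \<delta>\<close> \<open>0 \<le> \<eta>\<close> \<open>0 \<le> \<epsilon>\<close> by simp
  qed
qed

text \<open>
  Replacing the arguments by \<open>t\<close>-fold multiples leaves the bounds unchanged but multiplies each defect
  by \<open>t powr \<alpha>\<close>, which is unbounded in \<open>t\<close>; so the defects are zero.  The defect of homogeneity comes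
  first, since the other two need it in exact form to be scaled.
\<close>
lemma bounded_defects_imp_exact:
  fixes F :: "real \<Rightarrow> real \<Rightarrow> real"
  assumes "\<alpha> \<noteq> 0"
    and sy: "\<And>x y. x > 0 \<Longrightarrow> y > 0 \<Longrightarrow> \<bar>F x y - F y x\<bar> \<le> \<epsilon>"
    and co: "\<And>x y z. x > 0 \<Longrightarrow> y > 0 \<Longrightarrow> z > 0 \<Longrightarrow>
      \<bar>F (x + y) z + F x y - F x (y + z) - F y z\<bar> \<le> \<eta>"
    and homog: "\<And>t x y. t > 0 \<Longrightarrow> x > 0 \<Longrightarrow> y > 0 \<Longrightarrow>
      \<bar>F (t * x) (t * y) - t powr \<alpha> * F x y\<bar> \<le> \<delta>"
  shows "sym_cocycle_on {0<..} F"
    and "\<And>t x y. t > 0 \<Longrightarrow> x > 0 \<Longrightarrow> y > 0 \<Longrightarrow> F (t * x) (t * y) = t powr \<alpha> * F x y"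
proof -
  show exact: "F (t * x) (t * y) = t powr \<alpha> * F x y" if "t > 0" "x > 0" "y > 0" for t x y
  proof -
    have "F (t * x) (t * y) - t powr \<alpha> * F x y = 0"
    proof (rule homogeneous_bounded_imp_zero[OF \<open>\<alpha> \<noteq> 0\<close>])
      fix s :: real assume "s > 0"
      have "\<bar>F (s * (t * x)) (s * (t * y)) - s powr \<alpha> * F (t * x) (t * y)\<bar> \<le> \<delta>"
        using \<open>s > 0\<close> that by (intro homog) auto
      moreover have "\<bar>F (s * (t * x)) (s * (t * y)) - s powr \<alpha> * (t powr \<alpha> * F x y)\<bar> \<le> \<delta>"
        using homog[of "s * t" x y] \<open>s > 0\<close> that by (simp add: powr_mult mult.assoc)
      ultimately show "\<bar>s powr \<alpha> * (F (t * x) (t * y) - t powr \<alpha> * F x y)\<bar> \<le> 2 * \<delta>"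
        unfolding right_diff_distrib by linarith
    qed
    then show ?thesis by simp
  qed
  have "F x y = F y x" if "x > 0" "y > 0" for x y
  proof -
    have "F x y - F y x = 0"
    proof (rule homogeneous_bounded_imp_zero[OF \<open>\<alpha> \<noteq> 0\<close>])
      fix t :: real assume "t > 0"
      then show "\<bar>t powr \<alpha> * (F x y - F y x)\<bar> \<le> \<epsilon>"
        using sy[of "t * x" "t * y"] that by (simp add: right_diff_distrib exact)
    qed
    then show ?thesis by simp
  qed
  moreover have "F (x + y) z + F x y = F x (y + z) + F y z" if "x > 0" "y > 0" "z > 0" for x y z
  proof -
    have "F (x + y) z + F x y - F x (y + z) - F y z = 0"
    proof (rule homogeneous_bounded_imp_zero[OF \<open>\<alpha> \<noteq> 0\<close>])
      fix t :: real assume "t > 0"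
      then have "\<bar>F (t * (x + y)) (t * z) + F (t * x) (t * y) - F (t * x) (t * (y + z))
          - F (t * y) (t * z)\<bar> \<le> \<eta>"
        unfolding distrib_left using that by (intro co) auto
      then show "\<bar>t powr \<alpha> * (F (x + y) z + F x y - F x (y + z) - F y z)\<bar> \<le> \<eta>"
        using \<open>t > 0\<close> that
        by (simp add: exact right_diff_distrib distrib_left[of "t powr \<alpha>"])
    qed
    then show ?thesis by simp
  qed
  ultimately show "sym_cocycle_on {0<..} F"
    by (simp add: sym_cocycle_on_def)
qed

section \<open>Stability of the entropy equation\<close>

text \<open>
  By symmetry, applying the recursion to \<open>(x, y, z)\<close> and to \<open>(y, z, x)\<close> gives two approximations of
  nearly the same value, whence the approximate cocycle equation for \<open>H\<close> with third argument zero.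
\<close>
lemma entropy_defects:
  fixes H :: "real \<times> real \<times> real \<Rightarrow> real"
  assumes symm: "\<And>u v. u \<in> D \<Longrightarrow> rearrangement u v \<Longrightarrow> \<bar>H u - H v\<bar> \<le> \<epsilon>1"
    and rec: "\<And>x y z. (x, y, z) \<in> interior D \<Longrightarrow>
      \<bar>H (x, y, z) - H (x + y, 0, z) - H (x, y, 0)\<bar> \<le> \<epsilon>2"
    and pos: "x > 0" "y > 0" "z > 0"
  shows "\<bar>H (x, y, 0) - H (y, x, 0)\<bar> \<le> \<epsilon>1"
    and "\<bar>H (x, y, z) - (H (x + y, z, 0) + H (x, y, 0))\<bar> \<le> \<epsilon>1 + \<epsilon>2"
    and "\<bar>H (x + y, z, 0) + H (x, y, 0) - H (x, y + z, 0) - H (y, z, 0)\<bar> \<le> 3 * \<epsilon>1 + 2 * \<epsilon>2"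
proof -
  have perm: "\<bar>H (a, b, c) - H (a', b', c')\<bar> \<le> \<epsilon>1"
    if "a \<ge> 0" "b \<ge> 0" "c \<ge> 0" "a + b + c > 0" "{#a', b', c'#} = {#a, b, c#}" for a b c a' b' c'
    using that by (intro symm) (auto simp: D_def rearrangement_def)
  show "\<bar>H (x, y, 0) - H (y, x, 0)\<bar> \<le> \<epsilon>1"
    using pos by (intro perm) (auto simp: add_mset_commute)
  have xyz: "\<bar>H (x, y, z) - H (x + y, 0, z) - H (x, y, 0)\<bar> \<le> \<epsilon>2"
    and yzx: "\<bar>H (y, z, x) - H (y + z, 0, x) - H (y, z, 0)\<bar> \<le> \<epsilon>2"
    using pos by (auto intro!: rec simp: interior_D)
  have 1: "\<bar>H (x + y, 0, z) - H (x + y, z, 0)\<bar> \<le> \<epsilon>1"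
    using pos by (intro perm) (auto simp: add_mset_commute)
  have 2: "\<bar>H (y + z, 0, x) - H (x, y + z, 0)\<bar> \<le> \<epsilon>1"
    using pos by (intro perm) (auto simp: add_mset_commute)
  have 3: "\<bar>H (x, y, z) - H (y, z, x)\<bar> \<le> \<epsilon>1"
    using pos by (intro perm) (auto simp: add_mset_commute)
  show "\<bar>H (x, y, z) - (H (x + y, z, 0) + H (x, y, 0))\<bar> \<le> \<epsilon>1 + \<epsilon>2"
    using xyz 1 by linarith
  show "\<bar>H (x + y, z, 0) + H (x, y, 0) - H (x, y + z, 0) - H (y, z, 0)\<bar> \<le> 3 * \<epsilon>1 + 2 * \<epsilon>2"
    using xyz yzx 1 2 3 by linarith
qed

theorem theorem2p1:
  fixes H :: "real \<times> real \<times> real \<Rightarrow> real"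
    and \<epsilon>1 \<epsilon>2 \<epsilon>3 \<alpha> :: real
  assumes "\<epsilon>1 \<ge> 0" and "\<epsilon>2 \<ge> 0" and "\<epsilon>3 \<ge> 0"
    and symm: "\<forall>u v. u \<in> D \<longrightarrow> rearrangement u v \<longrightarrow> \<bar>H u - H v\<bar> \<le> \<epsilon>1"
    and rec: "\<forall>x y z. (x, y, z) \<in> interior D \<longrightarrow>
               \<bar>H (x, y, z) - H (x + y, 0, z) - H (x, y, 0)\<bar> \<le> \<epsilon>2"
    and homog: "\<forall>t x y. t > 0 \<longrightarrow> x > 0 \<longrightarrow> y > 0 \<longrightarrow>
               \<bar>H (t * x, t * y, 0) - t powr \<alpha> * H (x, y, 0)\<bar> \<le> \<epsilon>3"
  shows "(\<alpha> = 1 \<longrightarrow>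
            (\<exists>\<phi> :: real \<Rightarrow> real.
               (\<forall>x y. x > 0 \<longrightarrow> y > 0 \<longrightarrow> \<phi> (x * y) = x * \<phi> y + y * \<phi> x) \<and>
               (\<forall>x y z. (x, y, z) \<in> interior D \<longrightarrow>
                  \<bar>H (x, y, z) - (\<phi> (x + y + z) - \<phi> x - \<phi> y - \<phi> z)\<bar> \<le> \<epsilon>1 + \<epsilon>2)))
       \<and> (\<alpha> = 0 \<longrightarrow>
            (\<exists>a :: real. \<forall>x y z. (x, y, z) \<in> interior D \<longrightarrow>
               \<bar>H (x, y, z) - a\<bar> \<le> 8 * \<epsilon>3 + 25 * \<epsilon>2 + 49 * \<epsilon>1))
       \<and> (\<alpha> \<notin> {0, 1} \<longrightarrow>
            (\<exists>c :: real. \<forall>x y z. (x, y, z) \<in> interior D \<longrightarrow>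
               \<bar>H (x, y, z) - c * ((x + y + z) powr \<alpha> - x powr \<alpha> - y powr \<alpha> - z powr \<alpha>)\<bar>
                 \<le> \<epsilon>1 + \<epsilon>2))"
proof -
  define F where "F x y = H (x, y, 0)" for x y
  have F_sym: "\<bar>F x y - F y x\<bar> \<le> \<epsilon>1" if "x > 0" "y > 0" for x y
    unfolding F_def
    by (rule entropy_defects[of H \<epsilon>1 \<epsilon>2 x y 1]) (use symm rec that in auto)
  have F_coc: "\<bar>F (x + y) z + F x y - F x (y + z) - F y z\<bar> \<le> 3 * \<epsilon>1 + 2 * \<epsilon>2"
    if "x > 0" "y > 0" "z > 0" for x y z
    unfolding F_def by (rule entropy_defects[of H]) (use symm rec that in auto)
  have F_H: "\<bar>H (x, y, z) - (F (x + y) z + F x y)\<bar> \<le> \<epsilon>1 + \<epsilon>2"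
    if "x > 0" "y > 0" "z > 0" for x y z
    unfolding F_def by (rule entropy_defects[of H]) (use symm rec that in auto)
  have F_homog: "\<bar>F (t * x) (t * y) - t powr \<alpha> * F x y\<bar> \<le> \<epsilon>3"
    if "t > 0" "x > 0" "y > 0" for t x y
    unfolding F_def using homog that by simp
  note exact = bounded_defects_imp_exact[OF _ F_sym F_coc F_homog]
  show ?thesis
  proof (intro conjI impI)
    assume "\<alpha> = 1"
    have "sym_cocycle_on {0<..} F" by (rule exact(1)) (use \<open>\<alpha> = 1\<close> in auto)
    moreover have "F (t * x) (t * y) = t * F x y" if "t > 0" "x > 0" "y > 0" for t x y
      using exact(2)[of t x y] \<open>\<alpha> = 1\<close> that by simp
    ultimately interpret homogeneous_cocycle "odd_extension F"
      by (rule homogeneous_cocycle_odd_extension)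
    obtain \<phi> where
      add: "\<And>x y. \<phi> (x + y) = \<phi> x + \<phi> y + odd_extension F x y" and
      mult: "\<And>x y. \<phi> (x * y) = x * \<phi> y + y * \<phi> x"
      using exists_ring_section by metis
    have F_eq: "F x y = \<phi> (x + y) - \<phi> x - \<phi> y" if "x > 0" "y > 0" for x y
      using add[of x y] that by (simp add: odd_extension_def)
    show "\<exists>\<phi> :: real \<Rightarrow> real.
        (\<forall>x y. x > 0 \<longrightarrow> y > 0 \<longrightarrow> \<phi> (x * y) = x * \<phi> y + y * \<phi> x) \<and>
        (\<forall>x y z. (x, y, z) \<in> interior D \<longrightarrow>
           \<bar>H (x, y, z) - (\<phi> (x + y + z) - \<phi> x - \<phi> y - \<phi> z)\<bar> \<le> \<epsilon>1 + \<epsilon>2)"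
    proof (intro exI[of _ \<phi>] conjI allI impI)
      fix x y z assume "(x, y, z) \<in> interior D"
      then show "\<bar>H (x, y, z) - (\<phi> (x + y + z) - \<phi> x - \<phi> y - \<phi> z)\<bar> \<le> \<epsilon>1 + \<epsilon>2"
        using F_H[of x y z] by (simp add: interior_D F_eq)
    qed (rule mult)
  next
    assume "\<alpha> = 0"
    have F_near: "\<bar>F x y - F 1 1\<bar> \<le> 2 * (3 * \<epsilon>1 + 2 * \<epsilon>2) + 3 * \<epsilon>3 + \<epsilon>1"
      if "x > 0" "y > 0" for x y
    proof (rule degree_zero_nearly_constant[OF F_sym F_coc _ that])
      show "\<bar>F (t * x) (t * y) - F x y\<bar> \<le> \<epsilon>3" if "t > 0" "x > 0" "y > 0" for t x y
        using F_homog[OF that] \<open>\<alpha> = 0\<close> that by simp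
    qed
    have "\<bar>H (x, y, z) - 2 * F 1 1\<bar> \<le> 8 * \<epsilon>3 + 25 * \<epsilon>2 + 49 * \<epsilon>1"
      if "(x, y, z) \<in> interior D" for x y z
    proof -
      have pos: "x > 0" "y > 0" "z > 0" "x + y > 0" using that by (auto simp: interior_D)
      show ?thesis
        using F_H[OF pos(1-3)] F_near[OF pos(4,3)] F_near[OF pos(1,2)] assms(1-3) by argo
    qed
    then show "\<exists>a. \<forall>x y z. (x, y, z) \<in> interior D \<longrightarrow>
        \<bar>H (x, y, z) - a\<bar> \<le> 8 * \<epsilon>3 + 25 * \<epsilon>2 + 49 * \<epsilon>1"
      by blast
  next
    assume \<alpha>: "\<alpha> \<notin> {0, 1}"
    define c where "c = F 1 1 / (2 powr \<alpha> - 2)"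
    have F_eq: "F x y = c * ((x + y) powr \<alpha> - x powr \<alpha> - y powr \<alpha>)" if "x > 0" "y > 0" for x y
      unfolding c_def
    proof (rule powr_homogeneous_cocycle)
      show "sym_cocycle_on {0<..} F" by (rule exact(1)) (use \<alpha> in auto)
      show "F (t * x) (t * y) = t powr \<alpha> * F x y" if "t > 0" "x > 0" "y > 0" for t x y
        by (rule exact(2)) (use \<alpha> that in auto)
    qed (use \<alpha> that in auto)
    have "\<bar>H (x, y, z) - c * ((x + y + z) powr \<alpha> - x powr \<alpha> - y powr \<alpha> - z powr \<alpha>)\<bar>
        \<le> \<epsilon>1 + \<epsilon>2"
      if "(x, y, z) \<in> interior D" for x y z
    proof -
      have pos: "x > 0" "y > 0" "z > 0" using that by (auto simp: interior_D)
      then have "F (x + y) z + F x y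
          = c * ((x + y + z) powr \<alpha> - x powr \<alpha> - y powr \<alpha> - z powr \<alpha>)"
        by (simp add: F_eq algebra_simps)
      then show ?thesis using F_H[OF pos] by simp
    qed
    then show "\<exists>c. \<forall>x y z. (x, y, z) \<in> interior D \<longrightarrow>
        \<bar>H (x, y, z) - c * ((x + y + z) powr \<alpha> - x powr \<alpha> - y powr \<alpha> - z powr \<alpha>)\<bar>
          \<le> \<epsilon>1 + \<epsilon>2"
      by blast
  qed
qed

end
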